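(* Let $G_0=\mathbb{I}\oplus\mathbb{I}\ell$. For $v\in G_0\setminus 2G_0$ put $$G_v=G_0+\mathbb{Z}[\varphi]\,\frac v2 ,$$ which depends only on the projective line spanned by the class of $v$ in $G_0/2G_0\cong(\mathbb{Z}[\varphi]/2)^8\cong\mathbb{F}_4^8$. Then there is no $v\in G_0\setminus 2G_0$ (equivalently, no projective line of $\mathbb{F}_4^8$) for which all of the following tests hold simultaneously: (mixed coset) writing $v=a+b\ell$ with $a,b\in\mathbb{I}$, one has $a\notin 2\mathbb{I}$ and $b\notin 2\mathbb{I}$; (conjugation) $\overline{v/2}\in G_v$; (integral pairing) $B(v/2,g)\in\mathbb{Z}[\varphi]$ for all $g\in G_0$; (integral norm) $N(x)\in\mathbb{Z}[\varphi]$ for all $x\in G_v$; (multiplication) $G_v$ is closed under multiplication; (square closure) $(v/2)^2\in G_v$.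
   Context: Let $\varphi=(1+\sqrt5)/2$, $K=\mathbb{Q}(\sqrt5)$. $\mathbb{H}(K)$ is the quaternion algebra over $K$ with basis $1,i,j,k$, $i^2=j^2=k^2=ijk=-1$, standard conjugation. The icosian ring $\mathbb{I}\subset\mathbb{H}(K)$ is the free $\mathbb{Z}[\varphi]$-module with basis $$e_1=1,\quad e_2=i,\quad e_3=\tfrac12(1+i+j+k),\quad e_4=\tfrac12(-1+(\varphi-1)i-\varphi j).$$ $\mathbb{O}(K)=\mathbb{H}(K)\oplus\mathbb{H}(K)\ell$ is the Cayley--Dickson double with product $(a+b\ell)(c+d\ell)=(ac-\overline{d}b)+(da+b\overline{c})\ell$, conjugation $\overline{a+b\ell}=\overline{a}-b\ell$, and norm $N(x)=x\overline{x}$. The polar form is $B(x,y)=N(x+y)-N(x)-N(y)$. *)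

theory Defs
  imports Complex_Main "HOL-Algebra.QuotRing" "HOL-Algebra.Module"
begin

section \<open>The field K and its subring of integers\<close>

typedef K = "{x :: real. \<exists>a b :: rat. x = of_rat a + of_rat b * sqrt 5}"
  morphisms real_of_K K_of_real
  by auto

setup_lifting type_definition_K

instantiation K :: field
begin

lift_definition zero_K :: K is 0
  by (intro exI[of _ 0]) simp

lift_definition one_K :: K is 1
  by (rule exI[of _ 1], rule exI[of _ 0]) simp

lift_definition plus_K :: "K \<Rightarrow> K \<Rightarrow> K" is "(+)"
proof clarify
  fix a b c d :: rat
  show "\<exists>u v. of_rat a + of_rat b * sqrt 5 + (of_rat c + of_rat d * sqrt 5)
      = of_rat u + of_rat v * sqrt 5"
    by (rule exI[of _ "a + c"], rule exI[of _ "b + d"]) (simp add: of_rat_add algebra_simps)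
qed

lift_definition uminus_K :: "K \<Rightarrow> K" is uminus
proof clarify
  fix a b :: rat
  show "\<exists>u v. - (of_rat a + of_rat b * sqrt 5) = of_rat u + of_rat v * sqrt 5"
    by (rule exI[of _ "- a"], rule exI[of _ "- b"]) (simp add: of_rat_minus algebra_simps)
qed

lift_definition minus_K :: "K \<Rightarrow> K \<Rightarrow> K" is "(-)"
proof clarify
  fix a b c d :: rat
  show "\<exists>u v. of_rat a + of_rat b * sqrt 5 - (of_rat c + of_rat d * sqrt 5)
      = of_rat u + of_rat v * sqrt 5"
    by (rule exI[of _ "a - c"], rule exI[of _ "b - d"]) (simp add: of_rat_diff algebra_simps)
qed

lift_definition times_K :: "K \<Rightarrow> K \<Rightarrow> K" is "(*)"
proof clarify
  fix a b c d :: rat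
  show "\<exists>u v. (of_rat a + of_rat b * sqrt 5) * (of_rat c + of_rat d * sqrt 5)
      = of_rat u + of_rat v * sqrt 5"
    by (rule exI[of _ "a * c + 5 * b * d"], rule exI[of _ "a * d + b * c"])
       (simp add: of_rat_add of_rat_mult algebra_simps)
qed

lift_definition inverse_K :: "K \<Rightarrow> K" is inverse
proof clarify
  fix a b :: rat
  let ?x = "of_rat a + of_rat b * sqrt 5" and ?y = "of_rat a - of_rat b * sqrt 5"
  show "\<exists>u v. inverse ?x = of_rat u + of_rat v * sqrt 5"
  proof (cases "?y = 0")
    case True
    then have "?x = of_rat (2 * a)" by (simp add: of_rat_mult)
    then have "inverse ?x = of_rat (inverse (2 * a))" by (simp only: of_rat_inverse)
    then have "inverse ?x = of_rat (inverse (2 * a)) + of_rat 0 * sqrt 5"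
      by (simp only: of_rat_0 mult_zero_left add_0_right)
    then show ?thesis by blast
  next
    case False
    define n where "n = a * a - 5 * b * b"
    have n: "?x * ?y = of_rat n"
      by (simp add: n_def of_rat_diff of_rat_mult algebra_simps)
    have "inverse ?x = ?y / of_rat n"
      using False by (simp flip: n add: divide_simps)
    also have "\<dots> = of_rat (a / n) + of_rat (- b / n) * sqrt 5"
      by (simp add: of_rat_divide of_rat_minus diff_divide_distrib)
    finally show ?thesis by blast
  qed
qed

definition "x div y = x * inverse (y :: K)"

instance
proof
  fix a b c :: K
  show "a * b * c = a * (b * c)" by transfer simp
  show "a * b = b * a" by transfer simp
  show "1 * a = a" by transfer simp
  show "a + b + c = a + (b + c)" by transfer simp
  show "a + b = b + a" by transfer simp
  show "0 + a = a" by transfer simp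
  show "- a + a = 0" by transfer simp
  show "a - b = a + - b" by transfer simp
  show "(a + b) * c = a * c + b * c" by transfer (simp add: algebra_simps)
  show "(0 :: K) \<noteq> 1" by transfer simp
  show "a \<noteq> 0 \<Longrightarrow> inverse a * a = 1" by transfer simp
  show "a div b = a * inverse b" by (rule divide_K_def)
  show "inverse (0 :: K) = 0" by transfer simp
qed

end

instance K :: field_char_0
proof
  have of_nat: "real_of_K (of_nat n) = of_nat n" for n
    by (induction n) (simp_all add: zero_K.rep_eq one_K.rep_eq plus_K.rep_eq)
  show "inj (of_nat :: nat \<Rightarrow> K)"
    by (metis injI of_nat of_nat_eq_iff)
qed

lift_definition sqrt5 :: K is "sqrt 5"
  by (rule exI[of _ 0], rule exI[of _ 1]) simp

definition phi :: K ("\<phi>") where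
  "\<phi> = (1 + sqrt5) / 2"

lemma sqrt5_mult_self: "sqrt5 * sqrt5 = 5"
proof -
  have "sqrt5 * sqrt5 = 1 + 1 + 1 + 1 + 1" by transfer simp
  then show ?thesis by simp
qed

lemma phi_mult_self: "\<phi> * \<phi> = \<phi> + 1"
  by (simp add: phi_def field_simps sqrt5_mult_self)

definition Zphi :: "K set" where
  "Zphi = {of_int m + of_int n * \<phi> | m n. True}"


section \<open>Quaternions\<close>

datatype 'a quat = Quat (q_re: 'a) (q_i: 'a) (q_j: 'a) (q_k: 'a)

instantiation quat :: (comm_ring_1) ring_1
begin

definition "0 = Quat 0 0 0 0"
definition "1 = Quat 1 0 0 0"
definition "x + y = Quat (q_re x + q_re y) (q_i x + q_i y) (q_j x + q_j y) (q_k x + q_k y)"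
definition "x - y = Quat (q_re x - q_re y) (q_i x - q_i y) (q_j x - q_j y) (q_k x - q_k y)"
definition "- x = Quat (- q_re x) (- q_i x) (- q_j x) (- q_k x)"
definition "x * y = Quat
  (q_re x * q_re y - q_i x * q_i y - q_j x * q_j y - q_k x * q_k y)
  (q_re x * q_i y + q_i x * q_re y + q_j x * q_k y - q_k x * q_j y)
  (q_re x * q_j y - q_i x * q_k y + q_j x * q_re y + q_k x * q_i y)
  (q_re x * q_k y + q_i x * q_j y - q_j x * q_i y + q_k x * q_re y)"

instance
  by standard
     (simp_all add: zero_quat_def one_quat_def plus_quat_def minus_quat_def uminus_quat_def
        times_quat_def algebra_simps)

end

lemmas quat_arith_defs = zero_quat_def one_quat_def plus_quat_def minus_quat_def
  uminus_quat_def times_quat_def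

definition quat_i :: "'a :: comm_ring_1 quat" where "quat_i = Quat 0 1 0 0"
definition quat_j :: "'a :: comm_ring_1 quat" where "quat_j = Quat 0 0 1 0"
definition quat_k :: "'a :: comm_ring_1 quat" where "quat_k = Quat 0 0 0 1"

lemma quat_units:
  "quat_i * quat_i = (- 1 :: 'a :: comm_ring_1 quat)"
  "quat_j * quat_j = (- 1 :: 'a :: comm_ring_1 quat)"
  "quat_k * quat_k = (- 1 :: 'a :: comm_ring_1 quat)"
  "quat_i * quat_j * quat_k = (- 1 :: 'a :: comm_ring_1 quat)"
  by (simp_all add: quat_i_def quat_j_def quat_k_def quat_arith_defs)

definition quat_smult :: "'a :: comm_ring_1 \<Rightarrow> 'a quat \<Rightarrow> 'a quat" where
  "quat_smult c x = Quat (c * q_re x) (c * q_i x) (c * q_j x) (c * q_k x)"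

definition quat_cnj :: "'a :: comm_ring_1 quat \<Rightarrow> 'a quat" where
  "quat_cnj x = Quat (q_re x) (- q_i x) (- q_j x) (- q_k x)"


section \<open>The icosian ring\<close>

definition icos_e1 :: "K quat" where "icos_e1 = 1"
definition icos_e2 :: "K quat" where "icos_e2 = quat_i"
definition icos_e3 :: "K quat" where
  "icos_e3 = quat_smult (1/2) (1 + quat_i + quat_j + quat_k)"
definition icos_e4 :: "K quat" where
  "icos_e4 = quat_smult (1/2) (- 1 + quat_smult (\<phi> - 1) quat_i - quat_smult \<phi> quat_j)"

definition icosians :: "K quat set" where
  "icosians = {quat_smult c1 icos_e1 + quat_smult c2 icos_e2 + quat_smult c3 icos_e3
      + quat_smult c4 icos_e4 | c1 c2 c3 c4. {c1, c2, c3, c4} \<subseteq> Zphi}"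

lemma icosian_basis_independent:
  assumes "quat_smult c1 icos_e1 + quat_smult c2 icos_e2 + quat_smult c3 icos_e3
      + quat_smult c4 icos_e4 = 0"
  shows "c1 = 0" "c2 = 0" "c3 = 0" "c4 = 0"
proof -
  have "\<phi> \<noteq> 0"
    using phi_mult_self by auto
  then show "c1 = 0" "c2 = 0" "c3 = 0" "c4 = 0"
    using assms
    by (auto simp: quat_arith_defs quat_i_def quat_j_def quat_k_def quat_smult_def
        icos_e1_def icos_e2_def icos_e3_def icos_e4_def)
qed


section \<open>Octonions\<close>

text \<open>\<open>Oct a b\<close> stands for \<open>a + b\<ell>\<close>.\<close>

datatype 'a oct = Oct (oct_fst: "'a quat") (oct_snd: "'a quat")

instantiation oct :: (comm_ring_1) "{ab_group_add, one, times}"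
begin

definition "0 = Oct 0 0"
definition "1 = Oct 1 0"
definition "x + y = Oct (oct_fst x + oct_fst y) (oct_snd x + oct_snd y)"
definition "x - y = Oct (oct_fst x - oct_fst y) (oct_snd x - oct_snd y)"
definition "- x = Oct (- oct_fst x) (- oct_snd x)"
definition "x * y = (case (x, y) of (Oct a b, Oct c d) \<Rightarrow>
  Oct (a * c - quat_cnj d * b) (d * a + b * quat_cnj c))"

instance
  by standard
     (simp_all add: zero_oct_def plus_oct_def minus_oct_def uminus_oct_def)

end

lemmas oct_arith_defs = zero_oct_def one_oct_def plus_oct_def minus_oct_def
  uminus_oct_def times_oct_def

definition oct_smult :: "'a :: comm_ring_1 \<Rightarrow> 'a oct \<Rightarrow> 'a oct" where
  "oct_smult c x = Oct (quat_smult c (oct_fst x)) (quat_smult c (oct_snd x))"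

definition oct_cnj :: "'a :: comm_ring_1 oct \<Rightarrow> 'a oct" where
  "oct_cnj x = Oct (quat_cnj (oct_fst x)) (- oct_snd x)"

text \<open>The product of \<open>x\<close> with its conjugate is a scalar multiple of 1 (lemma below); the norm
  is that scalar, so that it takes values in the base ring.\<close>

definition oct_norm :: "'a :: comm_ring_1 oct \<Rightarrow> 'a" where
  "oct_norm x = q_re (oct_fst (x * oct_cnj x))"

lemma oct_mult_cnj: "x * oct_cnj x = oct_smult (oct_norm x) 1"
  by (cases x)
     (auto simp: oct_norm_def oct_smult_def oct_cnj_def quat_cnj_def quat_smult_def
        oct_arith_defs quat_arith_defs algebra_simps)

definition oct_polar :: "'a :: comm_ring_1 oct \<Rightarrow> 'a oct \<Rightarrow> 'a" where
  "oct_polar x y = oct_norm (x + y) - oct_norm x - oct_norm y"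


section \<open>The lattices and the tests\<close>

definition G0 :: "K oct set" where
  "G0 = {Oct a b | a b. a \<in> icosians \<and> b \<in> icosians}"

definition two_G0 :: "K oct set" where
  "two_G0 = oct_smult 2 ` G0"

definition half :: "K oct \<Rightarrow> K oct" where
  "half v = oct_smult (1/2) v"

definition Gv :: "K oct \<Rightarrow> K oct set" where
  "Gv v = {g + oct_smult c (half v) | g c. g \<in> G0 \<and> c \<in> Zphi}"

definition mixed_coset_test :: "K oct \<Rightarrow> bool" where
  "mixed_coset_test v \<longleftrightarrow>
     oct_fst v \<notin> quat_smult 2 ` icosians \<and> oct_snd v \<notin> quat_smult 2 ` icosians"

definition conjugation_test :: "K oct \<Rightarrow> bool" where
  "conjugation_test v \<longleftrightarrow> oct_cnj (half v) \<in> Gv v"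

definition integral_pairing_test :: "K oct \<Rightarrow> bool" where
  "integral_pairing_test v \<longleftrightarrow> (\<forall>g\<in>G0. oct_polar (half v) g \<in> Zphi)"

definition integral_norm_test :: "K oct \<Rightarrow> bool" where
  "integral_norm_test v \<longleftrightarrow> (\<forall>x\<in>Gv v. oct_norm x \<in> Zphi)"

definition multiplication_test :: "K oct \<Rightarrow> bool" where
  "multiplication_test v \<longleftrightarrow> (\<forall>x\<in>Gv v. \<forall>y\<in>Gv v. x * y \<in> Gv v)"

definition square_closure_test :: "K oct \<Rightarrow> bool" where
  "square_closure_test v \<longleftrightarrow> half v * half v \<in> Gv v"

definition passes_all_tests :: "K oct \<Rightarrow> bool" where
  "passes_all_tests v \<longleftrightarrow> mixed_coset_test v \<and> conjugation_test v \<and> integral_pairing_test v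
     \<and> integral_norm_test v \<and> multiplication_test v \<and> square_closure_test v"


section \<open>Reduction modulo 2 and projective lines\<close>

definition Zphi_ring :: "K ring" where
  "Zphi_ring = \<lparr>carrier = Zphi, monoid.mult = (*), one = 1, zero = 0, add = (+)\<rparr>"

definition F4 :: "K set ring" where
  "F4 = Zphi_ring Quot ((*) 2 ` Zphi)"

definition G0_class :: "K oct \<Rightarrow> K oct set" where
  "G0_class v = {v + w | w. w \<in> two_G0}"

text \<open>In HOL-Algebra a module is a record extending a ring record; its fields \<open>mult\<close> and \<open>one\<close>
  play no role and are left undefined. The union in \<open>smult\<close> is a single coset, as the sets
  united there are all equal.\<close>

definition G0_mod2 :: "(K set, K oct set) module" where
  "G0_mod2 = \<lparr>carrier = G0_class ` G0, monoid.mult = undefined, one = undefined,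
     zero = two_G0, add = (\<lambda>X Y. {x + y | x y. x \<in> X \<and> y \<in> Y}),
     smult = (\<lambda>C X. \<Union>c\<in>C. \<Union>x\<in>X. G0_class (oct_smult c x))\<rparr>"

definition F4_pow8 :: "(K set, nat \<Rightarrow> K set) module" where
  "F4_pow8 = \<lparr>carrier = {..<8} \<rightarrow>\<^sub>E carrier F4, monoid.mult = undefined, one = undefined,
     zero = (\<lambda>i\<in>{..<8}. \<zero>\<^bsub>F4\<^esub>), add = (\<lambda>X Y. \<lambda>i\<in>{..<8}. X i \<oplus>\<^bsub>F4\<^esub> Y i),
     smult = (\<lambda>C X. \<lambda>i\<in>{..<8}. C \<otimes>\<^bsub>F4\<^esub> X i)\<rparr>"

definition module_iso :: "(K set, 'a) module \<Rightarrow> (K set, 'b) module \<Rightarrow> ('a \<Rightarrow> 'b) \<Rightarrow> bool" where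
  "module_iso M N h \<longleftrightarrow> bij_betw h (carrier M) (carrier N)
     \<and> (\<forall>X\<in>carrier M. \<forall>Y\<in>carrier M. h (X \<oplus>\<^bsub>M\<^esub> Y) = h X \<oplus>\<^bsub>N\<^esub> h Y)
     \<and> (\<forall>C\<in>carrier F4. \<forall>X\<in>carrier M. h (C \<odot>\<^bsub>M\<^esub> X) = C \<odot>\<^bsub>N\<^esub> h X)"

definition line_spanned :: "(K set, 'a) module \<Rightarrow> 'a \<Rightarrow> 'a set" where
  "line_spanned M X = {C \<odot>\<^bsub>M\<^esub> X | C. C \<in> carrier F4}"

definition proj_lines :: "(K set, 'a) module \<Rightarrow> 'a set set" where
  "proj_lines M = {line_spanned M X | X. X \<in> carrier M \<and> X \<noteq> \<zero>\<^bsub>M\<^esub>}"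

end

theory Submission
  imports Defs
begin

text \<open>
  Let \<open>v = a + b\<ell>\<close> with \<open>G\<^sub>v\<close> closed under multiplication. Multiplying \<open>v/2\<close> on the left by an
  icosian \<open>g\<close> gives \<open>g a \<equiv> c(g) a\<close> modulo \<open>2\<I>\<close> with a scalar \<open>c(g)\<close>, so every commutator of
  icosians annihilates \<open>a\<close> modulo \<open>2\<I>\<close>. The commutator of \<open>e\<^sub>2\<close> and \<open>e\<^sub>4\<close> is \<open>-\<phi>k\<close>, a unit of
  \<open>\<I>\<close>; hence \<open>a \<in> 2\<I>\<close>, contrary to the mixed coset test. Conceptually, \<open>\<I>/2\<I>\<close> is a matrix
  algebra over \<open>\<F>\<^sub>4\<close>, which has no one-dimensional left ideal.
\<close>

section \<open>The ring of integers modulo 2\<close>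

text \<open>Companion of \<open>phi_mult_self\<close> for right-nested products: together the two
  lower every power of \<phi> to degree at most 1 once products are normalised.\<close>

lemma phi_mult_left: "\<phi> * (\<phi> * x) = \<phi> * x + x"
  by (simp add: mult.assoc [symmetric] phi_mult_self distrib_right)

lemma Zphi_of_int: "of_int m \<in> Zphi"
  unfolding Zphi_def by simp (metis add_0_right mult_zero_left of_int_0)

lemma Zphi_0: "0 \<in> Zphi" and Zphi_1: "1 \<in> Zphi" and Zphi_numeral: "numeral n \<in> Zphi"
  using Zphi_of_int [of 0] Zphi_of_int [of 1] Zphi_of_int [of "numeral n"] by simp_all

lemma Zphi_phi: "\<phi> \<in> Zphi"
  unfolding Zphi_def by simp (metis add_0_left mult_1 of_int_0 of_int_1)

lemma Zphi_add: "x \<in> Zphi \<Longrightarrow> y \<in> Zphi \<Longrightarrow> x + y \<in> Zphi"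
proof -
  have "of_int m + of_int n * \<phi> + (of_int m' + of_int n' * \<phi>)
      = of_int (m + m') + of_int (n + n') * \<phi>" for m n m' n'
    by (simp add: algebra_simps)
  then show "x \<in> Zphi \<Longrightarrow> y \<in> Zphi \<Longrightarrow> x + y \<in> Zphi"
    unfolding Zphi_def by blast
qed

lemma Zphi_uminus: "x \<in> Zphi \<Longrightarrow> - x \<in> Zphi"
proof -
  have "- (of_int m + of_int n * \<phi>) = of_int (- m) + of_int (- n) * \<phi>" for m n
    by simp
  then show "x \<in> Zphi \<Longrightarrow> - x \<in> Zphi"
    unfolding Zphi_def by blast
qed

lemma Zphi_diff: "x \<in> Zphi \<Longrightarrow> y \<in> Zphi \<Longrightarrow> x - y \<in> Zphi"
  using Zphi_add [of x "- y"] Zphi_uminus by simp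

lemma Zphi_mult: "x \<in> Zphi \<Longrightarrow> y \<in> Zphi \<Longrightarrow> x * y \<in> Zphi"
proof -
  have "(of_int m + of_int n * \<phi>) * (of_int m' + of_int n' * \<phi>)
      = of_int (m * m' + n * n') + of_int (m * n' + n * m' + n * n') * \<phi>" for m n m' n'
    by (simp add: algebra_simps phi_mult_self phi_mult_left)
  then show "x \<in> Zphi \<Longrightarrow> y \<in> Zphi \<Longrightarrow> x * y \<in> Zphi"
    unfolding Zphi_def by blast
qed

lemmas Zphi_closed = Zphi_0 Zphi_1 Zphi_numeral Zphi_phi Zphi_add Zphi_uminus Zphi_diff Zphi_mult

lemma cring_Zphi_ring: "cring Zphi_ring"
proof (rule cringI)
  show "abelian_group Zphi_ring"
  proof (rule abelian_groupI)
    fix x assume "x \<in> carrier Zphi_ring"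
    then show "\<exists>y\<in>carrier Zphi_ring. y \<oplus>\<^bsub>Zphi_ring\<^esub> x = \<zero>\<^bsub>Zphi_ring\<^esub>"
      by (intro bexI [of _ "- x"]) (auto simp: Zphi_ring_def Zphi_closed)
  qed (auto simp: Zphi_ring_def Zphi_closed)
  show "comm_monoid Zphi_ring"
    by unfold_locales (auto simp: Zphi_ring_def Zphi_closed algebra_simps)
qed (auto simp: Zphi_ring_def algebra_simps)

section \<open>The ideal generated by 2 and its maximality\<close>

definition Zphi2 :: "K set" where "Zphi2 = (*) 2 ` Zphi"

lemma Zphi2_add: "x \<in> Zphi2 \<Longrightarrow> y \<in> Zphi2 \<Longrightarrow> x + y \<in> Zphi2"
  unfolding Zphi2_def by (elim imageE) (metis distrib_left imageI Zphi_add)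

lemma Zphi2_mult: "x \<in> Zphi2 \<Longrightarrow> y \<in> Zphi \<Longrightarrow> x * y \<in> Zphi2"
  unfolding Zphi2_def by (elim imageE) (auto simp: mult.assoc Zphi_mult)

lemma Zphi2_0: "0 \<in> Zphi2"
  unfolding Zphi2_def using Zphi_0 by force

lemma Zphi2_uminus: "x \<in> Zphi2 \<Longrightarrow> - x \<in> Zphi2"
  using Zphi2_mult [of x "- 1"] Zphi_closed by simp

lemma Zphi2_subset: "Zphi2 \<subseteq> Zphi"
  unfolding Zphi2_def by (auto simp: Zphi_closed)

lemma ideal_Zphi2: "ideal Zphi2 Zphi_ring"
proof (rule idealI)
  interpret cring Zphi_ring by (rule cring_Zphi_ring)
  show "ring Zphi_ring" by (rule ring_axioms)
  \<comment> \<open>The additive inverse of the ring record is identified with negation in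
    \<open>K\<close>, for which closure is known.\<close>
  have "\<ominus>\<^bsub>Zphi_ring\<^esub> x = - x" if "x \<in> Zphi" for x
    using that by (intro minus_equality) (auto simp: Zphi_ring_def Zphi_closed)
  moreover have "x \<in> Zphi" if "x \<in> Zphi2" for x
    using that Zphi2_subset by blast
  ultimately show "subgroup Zphi2 (add_monoid Zphi_ring)"
    using Zphi2_subset Zphi2_0 Zphi2_uminus
    by (intro add.subgroupI) (auto simp: Zphi_ring_def Zphi2_add a_inv_def)
qed (auto simp: Zphi_ring_def Zphi2_mult mult.commute)

text \<open>Modulo 2 the norm form becomes \<open>m * m + m * n + n * n\<close>, which has no
  nontrivial zero over the field with two elements. This is the inertness of 2 in Z[\<phi>].\<close>

lemma norm_form_even:
  fixes m n :: int
  assumes "even (m * m + m * n - n * n)"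
  shows "even m" "even n"
  using assms by auto

text \<open>The second factor is the Galois conjugate of the first, since \<phi> has conjugate 1 -
  \<phi>.\<close>

lemma norm_form_eq: "(of_int m + of_int n * \<phi>) * (of_int (m + n) - of_int n * \<phi>)
    = of_int (m * m + m * n - n * n)"
  by (simp add: algebra_simps phi_mult_self phi_mult_left)

lemma in_Zphi2_iff: "of_int m + of_int n * \<phi> \<in> Zphi2 \<longleftrightarrow> even m \<and> even n"
proof
  assume "of_int m + of_int n * \<phi> \<in> Zphi2"
  then obtain p q where "of_int m + of_int n * \<phi> = 2 * (of_int p + of_int q * \<phi>)"
    unfolding Zphi2_def Zphi_def by auto
  then have "of_int (m - 2 * p) + of_int (n - 2 * q) * \<phi> = 0"
    by (simp add: algebra_simps)
  \<comment> \<open>A vanishing element has norm 0, which is even. The parity argument thus stands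
    in for linear independence of 1 and \<phi>.\<close>
  then have "of_int ((m - 2 * p) * (m - 2 * p) + (m - 2 * p) * (n - 2 * q)
      - (n - 2 * q) * (n - 2 * q)) = (0 :: K)"
    by (simp only: norm_form_eq [symmetric] mult_zero_left)
  then have "even ((m - 2 * p) * (m - 2 * p) + (m - 2 * p) * (n - 2 * q)
      - (n - 2 * q) * (n - 2 * q))"
    by (simp only: of_int_eq_0_iff even_zero)
  from norm_form_even [OF this] show "even m \<and> even n" by simp
next
  assume "even m \<and> even n"
  then obtain p q where "m = 2 * p" "n = 2 * q" by (auto elim!: evenE)
  then have "of_int m + of_int n * \<phi> = 2 * (of_int p + of_int q * \<phi>)"
    by (simp add: algebra_simps)
  then show "of_int m + of_int n * \<phi> \<in> Zphi2"
    unfolding Zphi2_def Zphi_def by blast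
qed

lemma maximalideal_Zphi2: "maximalideal Zphi2 Zphi_ring"
proof (rule maximalidealI [OF ideal_Zphi2])
  have "1 \<notin> Zphi2"
    using in_Zphi2_iff [of 1 0] by simp
  then show "carrier Zphi_ring \<noteq> Zphi2"
    using Zphi_1 by (auto simp: Zphi_ring_def)
next
  fix J assume J: "ideal J Zphi_ring" "Zphi2 \<subseteq> J" "J \<subseteq> carrier Zphi_ring"
  interpret ideal J Zphi_ring by (rule J(1))
  show "J = Zphi2 \<or> J = carrier Zphi_ring"
  proof (cases "J \<subseteq> Zphi2")
    case False
    then obtain x where x: "x \<in> J" "x \<notin> Zphi2" by blast
    then obtain m n where mn: "x = of_int m + of_int n * \<phi>"
      using J(3) by (auto simp: Zphi_ring_def Zphi_def)
    \<comment> \<open>An element outside the ideal has odd norm. This norm is a multiple of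
      \<open>x\<close>, and subtracting an even integer from it leaves 1.\<close>
    have "odd (m * m + m * n - n * n)"
      using norm_form_even [of m n] x(2) mn in_Zphi2_iff by blast
    then obtain q where q: "m * m + m * n - n * n = 2 * q + 1" by (rule oddE)
    have "x * (of_int (m + n) - of_int n * \<phi>) \<in> J"
      using I_r_closed [OF x(1)] by (simp add: Zphi_ring_def Zphi_closed Zphi_of_int del: of_int_add)
    then have "2 * of_int q + 1 \<in> J"
      unfolding mn norm_form_eq q by simp
    moreover have "2 * of_int (- q) \<in> J"
      using J(2) Zphi_of_int unfolding Zphi2_def by blast
    moreover have "x + y \<in> J" if "x \<in> J" "y \<in> J" for x y
      using additive_subgroup.a_closed [OF additive_subgroup_axioms that] by (simp add: Zphi_ring_def)
    ultimately have "(2 * of_int q + 1) + 2 * of_int (- q) \<in> J"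
      by blast
    then have "\<one>\<^bsub>Zphi_ring\<^esub> \<in> J"
      by (simp add: Zphi_ring_def)
    then show ?thesis using one_imp_carrier by blast
  qed (use J in blast)
qed

section \<open>The field with four elements and its cosets\<close>

theorem field_F4: "field F4"
  unfolding F4_def Zphi2_def [symmetric]
  by (rule maximalideal.quotient_is_field [OF maximalideal_Zphi2 cring_Zphi_ring])

text \<open>Serves both quotients, Z[\<phi>] modulo 2 and \<open>G0\<close> modulo
  \<open>two_G0\<close>. One inclusion is enough, because the condition on the difference is
  symmetric.\<close>

lemma coset_eq_iff:
  fixes S :: "'a :: ab_group_add set"
  assumes "0 \<in> S" "\<And>x y. x \<in> S \<Longrightarrow> y \<in> S \<Longrightarrow> x + y \<in> S" "\<And>x. x \<in> S \<Longrightarrow> - x \<in> S"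
  shows "{v + s | s. s \<in> S} = {w + s | s. s \<in> S} \<longleftrightarrow> v - w \<in> S"
proof
  assume "{v + s | s. s \<in> S} = {w + s | s. s \<in> S}"
  moreover have "v \<in> {v + s | s. s \<in> S}"
    using assms(1) by force
  ultimately show "v - w \<in> S" by auto
next
  have sub: "{v + s | s. s \<in> S} \<subseteq> {w + s | s. s \<in> S}" if "v - w \<in> S" for v w
  proof clarify
    fix s assume "s \<in> S"
    then have "v + s = w + (v - w + s) \<and> v - w + s \<in> S"
      using assms(2) that by simp
    then show "\<exists>t. v + s = w + t \<and> t \<in> S" by blast
  qed
  assume "v - w \<in> S"
  then show "{v + s | s. s \<in> S} = {w + s | s. s \<in> S}"
    using sub [of v w] sub [of w v] assms(3) [of "v - w"] by auto
qed

text \<open>A set comprehension, so that \<open>coset_eq_iff\<close> applies;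
  \<open>F4_class_r_coset\<close> identifies it with the coset of HOL-Algebra.\<close>

definition F4_class :: "K \<Rightarrow> K set" where
  "F4_class c = {c + d | d. d \<in> Zphi2}"

lemma F4_class_eq_iff: "F4_class c = F4_class d \<longleftrightarrow> c - d \<in> Zphi2"
  unfolding F4_class_def by (rule coset_eq_iff) (simp_all add: Zphi2_0 Zphi2_add Zphi2_uminus)

lemma in_F4_class: "d \<in> F4_class c \<longleftrightarrow> d - c \<in> Zphi2"
  unfolding F4_class_def by (auto intro!: exI [of _ "d - c"])

lemma F4_class_r_coset: "F4_class c = Zphi2 +>\<^bsub>Zphi_ring\<^esub> c"
  unfolding F4_class_def a_r_coset_def' by (auto simp: Zphi_ring_def add.commute)

lemma F4_carrier: "carrier F4 = F4_class ` Zphi"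
  unfolding F4_def Zphi2_def [symmetric] FactRing_def A_RCOSETS_def' F4_class_r_coset
  by (auto simp: Zphi_ring_def)

lemma F4_add:
  "c \<in> Zphi \<Longrightarrow> d \<in> Zphi \<Longrightarrow> F4_class c \<oplus>\<^bsub>F4\<^esub> F4_class d = F4_class (c + d)"
  using ideal.a_rcos_sum [OF ideal_Zphi2, of c d]
  unfolding F4_def Zphi2_def [symmetric] FactRing_def F4_class_r_coset
  by (simp add: Zphi_ring_def)

lemma F4_mult:
  "c \<in> Zphi \<Longrightarrow> d \<in> Zphi \<Longrightarrow> F4_class c \<otimes>\<^bsub>F4\<^esub> F4_class d = F4_class (c * d)"
  using ideal.rcoset_mult_add [OF ideal_Zphi2, of c d]
  unfolding F4_def Zphi2_def [symmetric] FactRing_def F4_class_r_coset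
  by (simp add: Zphi_ring_def)

lemma F4_one: "\<one>\<^bsub>F4\<^esub> = F4_class 1"
  unfolding F4_def Zphi2_def [symmetric] FactRing_def F4_class_r_coset
  by (simp add: Zphi_ring_def)

lemma card_F4: "card (carrier F4) = 4"
proof -
  \<comment> \<open>Cosets are parametrised by integer pairs. Equality depends only on parities, so
    0, 1, \<phi> and 1 + \<phi> represent them all.\<close>
  define f where "f = (\<lambda>(m, n). F4_class (of_int m + of_int n * \<phi>))"
  have f_eq_iff: "f (m, n) = f (m', n') \<longleftrightarrow> even (m - m') \<and> even (n - n')" for m n m' n'
  proof -
    have "of_int m + of_int n * \<phi> - (of_int m' + of_int n' * \<phi>)
        = of_int (m - m') + of_int (n - n') * \<phi>"
      by (simp add: algebra_simps)
    then show ?thesis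
      unfolding f_def by (simp only: F4_class_eq_iff in_Zphi2_iff case_prod_conv)
  qed
  have "f (m, n) \<in> f ` ({0, 1} \<times> {0, 1})" for m n
  proof (rule image_eqI)
    show "f (m, n) = f (m mod 2, n mod 2)"
      unfolding f_eq_iff by simp
  qed auto
  moreover have "carrier F4 = range f"
    unfolding F4_carrier f_def Zphi_def by auto
  ultimately have "carrier F4 = f ` ({0, 1} \<times> {0, 1})"
    by auto
  moreover have "inj_on f ({0, 1} \<times> {0, 1})"
    by (rule inj_onI) (auto simp: f_eq_iff)
  ultimately show ?thesis
    by (simp add: card_image)
qed

section \<open>Coordinates with respect to the icosian basis\<close>

lemma quat_smult_add_right: "quat_smult c (x + y) = quat_smult c x + quat_smult c y"
  and quat_smult_add_left: "quat_smult (c + d) x = quat_smult c x + quat_smult d x"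
  and quat_smult_diff_right: "quat_smult c (x - y) = quat_smult c x - quat_smult c y"
  and quat_smult_smult: "quat_smult c (quat_smult d x) = quat_smult (c * d) x"
  and quat_smult_1: "quat_smult 1 x = x"
  and quat_smult_mult_right: "x * quat_smult c y = quat_smult c (x * y)"
  by (simp_all add: quat_smult_def quat_arith_defs algebra_simps)

lemma oct_smult_add_right: "oct_smult c (x + y) = oct_smult c x + oct_smult c y"
  and oct_smult_add_left: "oct_smult (c + d) x = oct_smult c x + oct_smult d x"
  and oct_smult_smult: "oct_smult c (oct_smult d x) = oct_smult (c * d) x"
  and oct_smult_1: "oct_smult 1 x = x"
  by (simp_all add: oct_smult_def plus_oct_def quat_smult_add_right
      quat_smult_add_left quat_smult_smult quat_smult_1)

definition icos_comb :: "K \<Rightarrow> K \<Rightarrow> K \<Rightarrow> K \<Rightarrow> K quat" where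
  "icos_comb c1 c2 c3 c4 = quat_smult c1 icos_e1 + quat_smult c2 icos_e2 + quat_smult c3 icos_e3
      + quat_smult c4 icos_e4"

text \<open>Inverts \<open>icos_comb\<close>, solving from the last component upwards. The factor
  \<phi> - 1 in \<open>c4\<close> is the inverse of \<phi>.\<close>

definition icos_coord :: "K quat \<Rightarrow> nat \<Rightarrow> K" where
  "icos_coord q i =
    (let c3 = 2 * q_k q; c4 = 2 * (\<phi> - 1) * (q_k q - q_j q)
     in [q_re q - c3 / 2 + c4 / 2, q_i q - c3 / 2 - (\<phi> - 1) * c4 / 2, c3, c4] ! i)"

lemma less_4_cases: "(\<forall>i<4. P i) \<longleftrightarrow> P 0 \<and> P 1 \<and> P 2 \<and> P (3 :: nat)"
  by (auto simp: numeral_eq_Suc less_Suc_eq)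

lemma icos_comb_expand: "icos_comb c1 c2 c3 c4 = Quat
    (c1 + c3 / 2 - c4 / 2) (c2 + c3 / 2 + (\<phi> - 1) * c4 / 2) (c3 / 2 - \<phi> * c4 / 2) (c3 / 2)"
  by (simp add: icos_comb_def icos_e1_def icos_e2_def icos_e3_def icos_e4_def quat_i_def
      quat_j_def quat_k_def quat_smult_def quat_arith_defs algebra_simps diff_divide_distrib)

lemma icos_coord_comb:
  "icos_coord (icos_comb c1 c2 c3 c4) 0 = c1" "icos_coord (icos_comb c1 c2 c3 c4) 1 = c2"
  "icos_coord (icos_comb c1 c2 c3 c4) 2 = c3" "icos_coord (icos_comb c1 c2 c3 c4) 3 = c4"
  by (simp_all add: icos_comb_expand icos_coord_def Let_def field_simps phi_mult_self
      phi_mult_left numeral_eq_Suc)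

lemma icos_comb_coord:
  "icos_comb (icos_coord q 0) (icos_coord q 1) (icos_coord q 2) (icos_coord q 3) = q"
  by (cases q) (simp add: icos_comb_expand icos_coord_def Let_def field_simps phi_mult_self
      phi_mult_left numeral_eq_Suc)

lemma icosians_iff: "q \<in> icosians \<longleftrightarrow> (\<forall>i<4. icos_coord q i \<in> Zphi)"
proof
  assume "q \<in> icosians"
  then obtain c1 c2 c3 c4 where "q = icos_comb c1 c2 c3 c4" "{c1, c2, c3, c4} \<subseteq> Zphi"
    unfolding icosians_def icos_comb_def by blast
  then show "\<forall>i<4. icos_coord q i \<in> Zphi"
    by (simp add: less_4_cases icos_coord_comb [simplified])
next
  assume "\<forall>i<4. icos_coord q i \<in> Zphi"
  then have "{icos_coord q 0, icos_coord q 1, icos_coord q 2, icos_coord q 3} \<subseteq> Zphi"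
    by (simp add: less_4_cases)
  then show "q \<in> icosians"
    using icos_comb_coord [of q] unfolding icosians_def icos_comb_def by force
qed

lemma icos_coord_add: "i < 4 \<Longrightarrow> icos_coord (p + q) i = icos_coord p i + icos_coord q i"
  and icos_coord_smult: "i < 4 \<Longrightarrow> icos_coord (quat_smult c p) i = c * icos_coord p i"
proof -
  have "\<forall>i<4. icos_coord (p + q) i = icos_coord p i + icos_coord q i"
    unfolding less_4_cases
    by (simp add: icos_coord_def Let_def plus_quat_def numeral_eq_Suc field_simps)
  then show "i < 4 \<Longrightarrow> icos_coord (p + q) i = icos_coord p i + icos_coord q i" by blast
  have "\<forall>i<4. icos_coord (quat_smult c p) i = c * icos_coord p i"
    unfolding less_4_cases
    by (simp add: icos_coord_def Let_def quat_smult_def numeral_eq_Suc field_simps)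
  then show "i < 4 \<Longrightarrow> icos_coord (quat_smult c p) i = c * icos_coord p i" by blast
qed

lemma icosians_add: "p \<in> icosians \<Longrightarrow> q \<in> icosians \<Longrightarrow> p + q \<in> icosians"
  and icosians_smult: "c \<in> Zphi \<Longrightarrow> p \<in> icosians \<Longrightarrow> quat_smult c p \<in> icosians"
  by (simp_all add: icosians_iff icos_coord_add icos_coord_smult Zphi_closed)

lemma icosians_diff: "p \<in> icosians \<Longrightarrow> q \<in> icosians \<Longrightarrow> p - q \<in> icosians"
proof -
  have "p - q = p + quat_smult (- 1) q"
    by (simp add: quat_smult_def quat_arith_defs)
  then show "p \<in> icosians \<Longrightarrow> q \<in> icosians \<Longrightarrow> p - q \<in> icosians"
    by (simp only: icosians_add icosians_smult Zphi_closed)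
qed

lemma icosians_0: "0 \<in> icosians" and icosians_e2: "icos_e2 \<in> icosians"
  and icosians_e4: "icos_e4 \<in> icosians"
proof -
  have comb: "icos_comb c1 c2 c3 c4 \<in> icosians" if "{c1, c2, c3, c4} \<subseteq> Zphi" for c1 c2 c3 c4
    using that unfolding icosians_def icos_comb_def by blast
  have "icos_comb 0 0 0 0 = 0" "icos_comb 0 1 0 0 = icos_e2" "icos_comb 0 0 0 1 = icos_e4"
    by (simp_all add: icos_comb_def quat_smult_def quat_arith_defs)
  then show "0 \<in> icosians" "icos_e2 \<in> icosians" "icos_e4 \<in> icosians"
    using comb [of 0 0 0 0] comb [of 0 1 0 0] comb [of 0 0 0 1] by (simp_all add: Zphi_closed)
qed

text \<open>The coefficients form the matrix of left multiplication by \<open>icos_e2\<close> in the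
  icosian basis. Its entries lie in Z[\<phi>], so \<open>icosians\<close> is preserved; the next
  lemma does the same for \<open>icos_e4\<close>.\<close>

lemma icos_e2_mult_comb: "icos_e2 * icos_comb c1 c2 c3 c4
    = icos_comb (- c2 + (\<phi> - 2) * c3) (c1 + (\<phi> - 2) * c3 + (\<phi> - 1) * c4) (c3 - \<phi> * c4)
        ((2 * \<phi> - 2) * c3 - c4)"
  unfolding icos_comb_expand
  by (simp add: icos_e2_def quat_i_def times_quat_def field_simps phi_mult_self phi_mult_left)

lemma icos_e4_mult_comb: "icos_e4 * icos_comb c1 c2 c3 c4
    = icos_comb ((1 - \<phi>) * c2 + (2 - \<phi>) * c3 - c4) (- \<phi> * c2 + (2 - 2 * \<phi>) * c3)
        (\<phi> * c2 + (\<phi> - 1) * c3) (c1 + c2 + (3 - \<phi>) * c3 - c4)"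
  unfolding icos_comb_expand
  by (simp add: icos_e4_def quat_i_def quat_j_def quat_smult_def quat_arith_defs field_simps
      phi_mult_self phi_mult_left)

text \<open>Closure under these two left multiplications suffices below, since the commutator is
  built from \<open>icos_e2\<close> and \<open>icos_e4\<close>.\<close>

lemma icosians_e2_mult: "q \<in> icosians \<Longrightarrow> icos_e2 * q \<in> icosians"
  and icosians_e4_mult: "q \<in> icosians \<Longrightarrow> icos_e4 * q \<in> icosians"
  unfolding icosians_iff less_4_cases
  using icos_e2_mult_comb [of "icos_coord q 0" "icos_coord q 1" "icos_coord q 2" "icos_coord q 3"]
    icos_e4_mult_comb [of "icos_coord q 0" "icos_coord q 1" "icos_coord q 2" "icos_coord q 3"]
  by (simp_all only: icos_comb_coord icos_coord_comb) (intro conjI Zphi_closed; simp)+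

section \<open>The multiplication test\<close>

text \<open>Both \<open>Oct g 0\<close> and v/2 lie in \<open>Gv\<close>, hence so does their
  product, and twice its first component is \<open>g * a\<close>. The scalar \<open>c\<close> may
  depend on \<open>g\<close>.\<close>

lemma multiplication_test_left_eigenvector:
  assumes "Oct a b \<in> G0" "multiplication_test (Oct a b)" "g \<in> icosians"
  obtains c p where "c \<in> Zphi" "p \<in> icosians" "g * a = quat_smult c a + quat_smult 2 p"
proof -
  let ?v = "Oct a b"
  have "Oct g 0 \<in> Gv ?v"
  proof -
    have "Oct g 0 = Oct g 0 + oct_smult 0 (half ?v)"
      by (simp add: oct_smult_def quat_smult_def oct_arith_defs quat_arith_defs)
    moreover have "Oct g 0 \<in> G0"
      using assms(3) icosians_0 by (auto simp: G0_def)
    ultimately show ?thesis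
      unfolding Gv_def using Zphi_0 by blast
  qed
  moreover have "half ?v \<in> Gv ?v"
  proof -
    have "half ?v = Oct 0 0 + oct_smult 1 (half ?v)"
      by (simp add: oct_smult_1 flip: zero_oct_def)
    moreover have "Oct 0 0 \<in> G0"
      using icosians_0 by (auto simp: G0_def)
    ultimately show ?thesis
      unfolding Gv_def using Zphi_1 by blast
  qed
  ultimately have "Oct g 0 * half ?v \<in> Gv ?v"
    using assms(2) by (simp add: multiplication_test_def)
  then obtain p r c where pc: "p \<in> icosians" "c \<in> Zphi"
      "Oct g 0 * half ?v = Oct p r + oct_smult c (half ?v)"
    unfolding Gv_def G0_def by blast
  \<comment> \<open>First components are compared. As \<open>Oct g 0\<close> has second component 0,
    the Cayley-Dickson product begins with \<open>g\<close> times a/2.\<close>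
  then have "g * quat_smult (1/2) a = p + quat_smult (c * (1/2)) a"
    by (simp add: half_def oct_smult_def times_oct_def plus_oct_def quat_smult_smult)
  then have "quat_smult 2 (g * quat_smult (1/2) a) = quat_smult 2 (p + quat_smult (c * (1/2)) a)"
    by simp
  then have "g * a = quat_smult c a + quat_smult 2 p"
    by (simp add: quat_smult_mult_right quat_smult_add_right quat_smult_smult quat_smult_1 add.commute)
  with pc that show thesis by blast
qed

text \<open>The commutator \<open>-\<phi>k\<close> has square \<open>-\<phi>\<^sup>2\<close>, whose inverse is \<open>\<phi> - 2\<close>.\<close>

lemma commutator_e2_e4_unit:
  "quat_smult (\<phi> - 2) ((icos_e2 * icos_e4 - icos_e4 * icos_e2)
      * ((icos_e2 * icos_e4 - icos_e4 * icos_e2) * q)) = q"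
  by (cases q) (simp add: icos_e2_def icos_e4_def quat_i_def quat_j_def quat_smult_def
      quat_arith_defs field_simps phi_mult_self phi_mult_left)

lemma multiplication_test_imp_fst_even:
  assumes "Oct a b \<in> G0" "multiplication_test (Oct a b)"
  shows "a \<in> quat_smult 2 ` icosians"
proof -
  obtain c x where x: "c \<in> Zphi" "x \<in> icosians" "icos_e2 * a = quat_smult c a + quat_smult 2 x"
    using multiplication_test_left_eigenvector [OF assms icosians_e2] by blast
  obtain d y where y: "d \<in> Zphi" "y \<in> icosians" "icos_e4 * a = quat_smult d a + quat_smult 2 y"
    using multiplication_test_left_eigenvector [OF assms icosians_e4] by blast
  define u where "u = icos_e2 * icos_e4 - icos_e4 * icos_e2"
  \<comment> \<open>Half of the value of the commutator at \<open>a\<close>: the terms c d a arising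
    from the two orders of multiplication cancel.\<close>
  define z where "z = quat_smult d x + icos_e2 * y - quat_smult c y - icos_e4 * x"
  have "u * a = icos_e2 * (icos_e4 * a) - icos_e4 * (icos_e2 * a)"
    by (simp add: u_def left_diff_distrib mult.assoc)
  \<comment> \<open>Only the inner products are expanded here; the products
    \<open>icos_e2 * a\<close> and \<open>icos_e4 * a\<close> that reappear are expanded
    next.\<close>
  also have "\<dots> = quat_smult d (icos_e2 * a) + quat_smult 2 (icos_e2 * y)
      - (quat_smult c (icos_e4 * a) + quat_smult 2 (icos_e4 * x))"
    by (subst x(3), subst y(3)) (simp add: distrib_left quat_smult_mult_right)
  also have "\<dots> = quat_smult 2 z"
    unfolding x(3) y(3) z_def
    by (simp add: quat_smult_add_right quat_smult_diff_right quat_smult_smult mult.commute)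
  finally have ua: "u * a = quat_smult 2 z" .
  \<comment> \<open>The inverse of \<open>u\<close> is (\<phi> - 2) u, so \<open>a\<close> is
    recovered from \<open>u * a\<close> and inherits the factor 2.\<close>
  have "a = quat_smult (\<phi> - 2) (u * (u * a))"
    unfolding u_def commutator_e2_e4_unit ..
  also have "\<dots> = quat_smult 2 (quat_smult (\<phi> - 2) (u * z))"
    by (simp add: ua quat_smult_mult_right quat_smult_smult mult.commute)
  finally have "a = quat_smult 2 (quat_smult (\<phi> - 2) (u * z))" .
  \<comment> \<open>Expanding \<open>u\<close> leaves nested left multiplications by
    \<open>icos_e2\<close> and \<open>icos_e4\<close>, which preserve
    \<open>icosians\<close>.\<close>
  moreover have "u * z \<in> icosians"
    using x(1,2) y(1,2)
    by (simp add: u_def z_def left_diff_distrib mult.assoc icosians_add icosians_diff icosians_smult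
        icosians_e2_mult icosians_e4_mult)
  ultimately show ?thesis
    by (auto intro!: imageI icosians_smult Zphi_closed)
qed

corollary no_vector_passes_all_tests:
  assumes "v \<in> G0"
  shows "\<not> passes_all_tests v"
  using assms multiplication_test_imp_fst_even [of "oct_fst v" "oct_snd v"]
  by (auto simp: passes_all_tests_def mixed_coset_test_def)

section \<open>The reduction of the lattice modulo 2\<close>

definition oct_coord :: "K oct \<Rightarrow> nat \<Rightarrow> K" where
  "oct_coord v i = (if i < 4 then icos_coord (oct_fst v) i else icos_coord (oct_snd v) (i - 4))"

lemma less_8_split: "(\<forall>i<8. P i) \<longleftrightarrow> (\<forall>i<4. P i) \<and> (\<forall>i<4. P (i + 4 :: nat))"
proof (intro iffI allI impI)
  fix i :: nat
  assume "(\<forall>i<4. P i) \<and> (\<forall>i<4. P (i + 4))" "i < 8"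
  moreover have "i = (i - 4) + 4 \<and> i - 4 < 4" if "\<not> i < 4"
    using \<open>i < 8\<close> that by simp
  ultimately show "P i" by metis
qed auto

lemma oct_coord_add: "i < 8 \<Longrightarrow> oct_coord (v + w) i = oct_coord v i + oct_coord w i"
  and oct_coord_smult: "i < 8 \<Longrightarrow> oct_coord (oct_smult c v) i = c * oct_coord v i"
  by (simp_all add: oct_coord_def plus_oct_def oct_smult_def icos_coord_add icos_coord_smult)

lemma oct_coord_uminus: "i < 8 \<Longrightarrow> oct_coord (- v) i = - oct_coord v i"
proof -
  have "- v = oct_smult (- 1) v"
    by (simp add: oct_smult_def quat_smult_def oct_arith_defs quat_arith_defs)
  then show "i < 8 \<Longrightarrow> oct_coord (- v) i = - oct_coord v i"
    by (simp only: oct_coord_smult) simp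
qed

lemma oct_coord_diff: "i < 8 \<Longrightarrow> oct_coord (v - w) i = oct_coord v i - oct_coord w i"
  using oct_coord_add [of i v "- w"] by (simp add: oct_coord_uminus)

lemma oct_coord_0: "i < 8 \<Longrightarrow> oct_coord 0 i = 0"
  using oct_coord_diff [of i 0 0] by simp

text \<open>Supplies preimages when the coordinate map is shown to be onto
  \<open>F4_pow8\<close>.\<close>

lemma oct_coord_surj: obtains v where "\<And>i. i < 8 \<Longrightarrow> oct_coord v i = c i"
proof
  let ?v = "Oct (icos_comb (c 0) (c 1) (c 2) (c 3)) (icos_comb (c 4) (c 5) (c 6) (c 7))"
  have "\<forall>i<8. oct_coord ?v i = c i"
    unfolding less_8_split less_4_cases by (simp add: oct_coord_def icos_coord_comb [simplified])
  then show "oct_coord ?v i = c i" if "i < 8" for i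
    using that by blast
qed

lemma G0_iff: "v \<in> G0 \<longleftrightarrow> (\<forall>i<8. oct_coord v i \<in> Zphi)"
  by (cases v) (auto simp: G0_def less_8_split oct_coord_def icosians_iff)

text \<open>Halving turns the two sides into membership in \<open>G0\<close> and in Z[\<phi>], where
  \<open>G0_iff\<close> applies.\<close>

lemma two_G0_iff: "v \<in> two_G0 \<longleftrightarrow> (\<forall>i<8. oct_coord v i \<in> Zphi2)"
proof -
  have "v \<in> two_G0 \<longleftrightarrow> oct_smult (1/2) v \<in> G0"
  proof
    assume "oct_smult (1/2) v \<in> G0"
    then show "v \<in> two_G0"
      unfolding two_G0_def by (rule rev_image_eqI) (simp add: oct_smult_smult oct_smult_1)
  qed (auto simp: two_G0_def oct_smult_smult oct_smult_1)
  moreover have "x \<in> Zphi2 \<longleftrightarrow> 1/2 * x \<in> Zphi" for x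
    unfolding Zphi2_def by (auto intro: rev_image_eqI)
  ultimately show ?thesis
    by (simp add: G0_iff oct_coord_smult)
qed

lemma G0_add: "v \<in> G0 \<Longrightarrow> w \<in> G0 \<Longrightarrow> v + w \<in> G0"
  and G0_uminus: "v \<in> G0 \<Longrightarrow> - v \<in> G0"
  and G0_smult: "c \<in> Zphi \<Longrightarrow> v \<in> G0 \<Longrightarrow> oct_smult c v \<in> G0"
  and G0_0: "0 \<in> G0"
  by (simp_all add: G0_iff oct_coord_add oct_coord_uminus oct_coord_smult oct_coord_0 Zphi_closed)

lemma two_G0_add: "v \<in> two_G0 \<Longrightarrow> w \<in> two_G0 \<Longrightarrow> v + w \<in> two_G0"
  and two_G0_uminus: "v \<in> two_G0 \<Longrightarrow> - v \<in> two_G0"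
  and two_G0_0: "0 \<in> two_G0"
  by (simp_all add: two_G0_iff oct_coord_add oct_coord_uminus oct_coord_0 Zphi2_add Zphi2_uminus
      Zphi2_0)

section \<open>The quotient of \<open>G0\<close> by \<open>two_G0\<close> as a vector space\<close>

lemma G0_class_eq_iff: "G0_class v = G0_class w \<longleftrightarrow> v - w \<in> two_G0"
  unfolding G0_class_def by (rule coset_eq_iff) (simp_all add: two_G0_0 two_G0_add two_G0_uminus)

lemma in_G0_class: "w \<in> G0_class v \<longleftrightarrow> w - v \<in> two_G0"
  unfolding G0_class_def by (auto intro!: exI [of _ "w - v"])

lemma G0_class_add:
  "{x + y | x y. x \<in> G0_class v \<and> y \<in> G0_class w} = G0_class (v + w)"
proof (intro equalityI subsetI)
  fix z assume "z \<in> G0_class (v + w)"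
  then have "z - v \<in> G0_class w"
    by (simp add: in_G0_class algebra_simps)
  moreover have "v \<in> G0_class v"
    by (simp add: in_G0_class two_G0_0)
  moreover have "z = v + (z - v)" by simp
  ultimately show "z \<in> {x + y | x y. x \<in> G0_class v \<and> y \<in> G0_class w}" by blast
next
  fix z assume "z \<in> {x + y | x y. x \<in> G0_class v \<and> y \<in> G0_class w}"
  then obtain x y where "z = x + y" "x - v \<in> two_G0" "y - w \<in> two_G0"
    by (auto simp: in_G0_class)
  then show "z \<in> G0_class (v + w)"
    using two_G0_add [of "x - v" "y - w"] by (simp add: in_G0_class algebra_simps)
qed

lemma G0_class_smult:
  assumes "c \<in> Zphi" "v \<in> G0"
  shows "(\<Union>d\<in>F4_class c. \<Union>x\<in>G0_class v. G0_class (oct_smult d x)) = G0_class (oct_smult c v)"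
proof -
  have "G0_class (oct_smult d x) = G0_class (oct_smult c v)"
    if "d \<in> F4_class c" "x \<in> G0_class v" for d x
    unfolding G0_class_eq_iff two_G0_iff
  proof (intro allI impI)
    fix i :: nat assume i: "i < 8"
    have dc: "d - c \<in> Zphi2" and xv: "oct_coord x i - oct_coord v i \<in> Zphi2"
      using that i by (simp_all add: in_F4_class in_G0_class two_G0_iff oct_coord_diff)
    moreover have "oct_coord v i \<in> Zphi" "d \<in> Zphi"
      using assms i dc Zphi2_subset Zphi_add [of "d - c" c] by (auto simp: G0_iff)
    \<comment> \<open>The difference d x - c v splits as d (x - v) + (d - c) v, and each summand has
      a factor that vanishes modulo 2.\<close>
    ultimately have "(oct_coord x i - oct_coord v i) * d + (d - c) * oct_coord v i \<in> Zphi2"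
      by (intro Zphi2_add Zphi2_mult)
    then show "oct_coord (oct_smult d x - oct_smult c v) i \<in> Zphi2"
      using i by (simp add: oct_coord_diff oct_coord_smult algebra_simps)
  qed
  \<comment> \<open>The union ranges over nonempty sets, so it equals the common coset.\<close>
  moreover have "c \<in> F4_class c" "v \<in> G0_class v"
    by (simp_all add: in_F4_class in_G0_class Zphi2_0 two_G0_0)
  ultimately show ?thesis by blast
qed

text \<open>Rules on representatives, by which the module axioms are verified in \<open>G0\<close>
  itself.\<close>

lemma G0_mod2_carrier: "carrier G0_mod2 = G0_class ` G0"
  and G0_mod2_zero: "\<zero>\<^bsub>G0_mod2\<^esub> = G0_class 0"
  and G0_mod2_add: "G0_class v \<oplus>\<^bsub>G0_mod2\<^esub> G0_class w = G0_class (v + w)"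
  and G0_mod2_smult:
    "c \<in> Zphi \<Longrightarrow> v \<in> G0 \<Longrightarrow> F4_class c \<odot>\<^bsub>G0_mod2\<^esub> G0_class v = G0_class (oct_smult c v)"
  using G0_class_add [of v w] G0_class_smult [of c v]
  by (simp_all add: G0_mod2_def) (simp add: G0_class_def)

theorem module_G0_mod2: "Module.module F4 G0_mod2"
proof (rule moduleI)
  interpret field F4 by (rule field_F4)
  show "cring F4" by (rule cring_axioms)
  show "abelian_group G0_mod2"
  proof (rule abelian_groupI)
    fix x assume "x \<in> carrier G0_mod2"
    then obtain v where "v \<in> G0" "x = G0_class v"
      by (auto simp: G0_mod2_carrier)
    then show "\<exists>y\<in>carrier G0_mod2. y \<oplus>\<^bsub>G0_mod2\<^esub> x = \<zero>\<^bsub>G0_mod2\<^esub>"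
      by (intro bexI [of _ "G0_class (- v)"])
         (simp_all add: G0_mod2_carrier G0_mod2_add G0_mod2_zero G0_uminus)
  qed (auto simp: G0_mod2_carrier G0_mod2_add G0_mod2_zero G0_add G0_0 ac_simps
      intro!: imageI)
qed (auto simp: F4_carrier F4_add F4_mult F4_one G0_mod2_carrier G0_mod2_add G0_mod2_smult
    Zphi_closed G0_smult G0_add oct_smult_add_left oct_smult_add_right oct_smult_smult oct_smult_1)

section \<open>The coordinate space and the isomorphism with it\<close>

lemma F4_pow8_mem: "x \<in> carrier F4_pow8 \<Longrightarrow> i < 8 \<Longrightarrow> x i \<in> carrier F4"
  by (auto simp: F4_pow8_def)

text \<open>Vectors are extensional functions, so the unit laws hold as equalities of
  functions.\<close>

lemma F4_pow8_restrict: "x \<in> carrier F4_pow8 \<Longrightarrow> (\<lambda>i\<in>{..<8}. x i) = x"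
  by (auto simp: F4_pow8_def PiE_def intro: extensional_restrict)

lemma F4_pow8_ops:
  "(\<lambda>i\<in>{..<8}. f i) \<in> carrier F4_pow8 \<longleftrightarrow> (\<forall>i<8. f i \<in> carrier F4)"
  "x \<oplus>\<^bsub>F4_pow8\<^esub> y = (\<lambda>i\<in>{..<8}. x i \<oplus>\<^bsub>F4\<^esub> y i)"
  "C \<odot>\<^bsub>F4_pow8\<^esub> x = (\<lambda>i\<in>{..<8}. C \<otimes>\<^bsub>F4\<^esub> x i)"
  "\<zero>\<^bsub>F4_pow8\<^esub> = (\<lambda>i\<in>{..<8}. \<zero>\<^bsub>F4\<^esub>)"
  by (auto simp: F4_pow8_def)

theorem module_F4_pow8: "Module.module F4 F4_pow8"
proof -
  interpret field F4 by (rule field_F4)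
  note simps = F4_pow8_ops F4_pow8_mem
  show ?thesis
  proof (rule moduleI)
    show "abelian_group F4_pow8"
    proof (rule abelian_groupI)
      fix x assume x: "x \<in> carrier F4_pow8"
      show "\<exists>y\<in>carrier F4_pow8. y \<oplus>\<^bsub>F4_pow8\<^esub> x = \<zero>\<^bsub>F4_pow8\<^esub>"
        by (rule bexI [of _ "\<lambda>i\<in>{..<8}. \<ominus>\<^bsub>F4\<^esub> x i"])
           (simp_all add: simps x l_neg cong: restrict_cong)
      show "\<zero>\<^bsub>F4_pow8\<^esub> \<oplus>\<^bsub>F4_pow8\<^esub> x = x"
        using F4_pow8_restrict [OF x] by (simp add: simps x cong: restrict_cong)
    qed (simp_all add: simps a_ac cong: restrict_cong)
  next
    fix x assume x: "x \<in> carrier F4_pow8"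
    show "\<one>\<^bsub>F4\<^esub> \<odot>\<^bsub>F4_pow8\<^esub> x = x"
      using F4_pow8_restrict [OF x] by (simp add: simps x cong: restrict_cong)
  qed (simp_all add: simps cring_axioms l_distr r_distr m_assoc cong: restrict_cong)
qed

theorem G0_mod2_iso_F4_pow8: "\<exists>h. module_iso G0_mod2 F4_pow8 h"
proof
  \<comment> \<open>A representative is chosen and its coordinates are reduced. Any choice gives the
    same value, since representatives differ by elements of \<open>two_G0\<close>.\<close>
  define h where "h X = (\<lambda>i\<in>{..<8}. F4_class (oct_coord (SOME v. v \<in> X) i))" for X
  have h: "h (G0_class v) = (\<lambda>i\<in>{..<8}. F4_class (oct_coord v i))" for v
  proof -
    have "(SOME w. w \<in> G0_class v) \<in> G0_class v"
      by (rule someI [of _ v]) (simp add: in_G0_class two_G0_0)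
    then show ?thesis
      unfolding h_def
      by (intro restrict_ext) (simp add: in_G0_class two_G0_iff F4_class_eq_iff oct_coord_diff)
  qed
  show "module_iso G0_mod2 F4_pow8 h"
    unfolding module_iso_def
  proof (intro conjI ballI bij_betw_imageI inj_onI)
    fix X Y assume "X \<in> carrier G0_mod2" "Y \<in> carrier G0_mod2" "h X = h Y"
    then obtain v w where XY: "X = G0_class v" "Y = G0_class w"
      by (auto simp: G0_mod2_carrier)
    have "F4_class (oct_coord v i) = F4_class (oct_coord w i)" if "i < 8" for i
      using fun_cong [OF \<open>h X = h Y\<close>, of i] that by (simp add: XY h)
    then show "X = Y"
      unfolding XY G0_class_eq_iff two_G0_iff by (simp add: oct_coord_diff F4_class_eq_iff)
  next
    show "h ` carrier G0_mod2 = carrier F4_pow8"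
    proof (intro equalityI subsetI)
      fix x assume "x \<in> h ` carrier G0_mod2"
      then show "x \<in> carrier F4_pow8"
        by (auto simp: G0_mod2_carrier h F4_pow8_def F4_carrier G0_iff)
    next
      fix x assume "x \<in> carrier F4_pow8"
      then have x: "x \<in> {..<8} \<rightarrow>\<^sub>E F4_class ` Zphi"
        by (simp add: F4_pow8_def F4_carrier)
      \<comment> \<open>The eight residue classes are lifted to Z[\<phi>] and assembled into a
        lattice vector.\<close>
      then have "\<forall>i<8. \<exists>c. c \<in> Zphi \<and> x i = F4_class c"
        by (auto simp: PiE_def Pi_def)
      then obtain c where c: "i < 8 \<Longrightarrow> c i \<in> Zphi \<and> x i = F4_class (c i)" for i
        by metis
      obtain v where v: "i < 8 \<Longrightarrow> oct_coord v i = c i" for i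
        by (blast intro: oct_coord_surj [of c])
      have "x = h (G0_class v)"
        unfolding h by (rule PiE_ext [OF x]) (auto simp: v c)
      moreover have "v \<in> G0"
        by (simp add: G0_iff v c)
      ultimately show "x \<in> h ` carrier G0_mod2"
        by (auto simp: G0_mod2_carrier)
    qed
  next
    fix X Y assume "X \<in> carrier G0_mod2" "Y \<in> carrier G0_mod2"
    then show "h (X \<oplus>\<^bsub>G0_mod2\<^esub> Y) = h X \<oplus>\<^bsub>F4_pow8\<^esub> h Y"
      by (auto simp: G0_mod2_carrier G0_mod2_add h F4_pow8_def oct_coord_add F4_add G0_iff
          intro!: restrict_ext)
  next
    fix C X assume "C \<in> carrier F4" "X \<in> carrier G0_mod2"
    then show "h (C \<odot>\<^bsub>G0_mod2\<^esub> X) = C \<odot>\<^bsub>F4_pow8\<^esub> h X"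
      by (auto simp: G0_mod2_carrier F4_carrier G0_mod2_smult h F4_pow8_def oct_coord_smult F4_mult
          G0_iff intro!: restrict_ext)
  qed
qed

section \<open>Dependence of \<open>Gv\<close> on the projective line\<close>

lemma Gv_subset:
  assumes "w \<in> G0" "G0_class v \<in> line_spanned G0_mod2 (G0_class w)"
  shows "Gv v \<subseteq> Gv w"
proof -
  obtain c where c: "c \<in> Zphi" "G0_class v = G0_class (oct_smult c w)"
    using assms by (auto simp: line_spanned_def F4_carrier G0_mod2_smult)
  then obtain g where g: "g \<in> G0" "v - oct_smult c w = oct_smult 2 g"
    by (auto simp: G0_class_eq_iff two_G0_def)
  \<comment> \<open>Halving v = 2 g + c w turns the congruence into a shift by a lattice vector,
    which \<open>Gv\<close> absorbs.\<close>
  have half_v: "half v = g + oct_smult c (half w)"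
  proof -
    have "v = oct_smult 2 g + oct_smult c w"
      using g(2) by (simp add: algebra_simps)
    then show ?thesis
      by (simp add: half_def oct_smult_add_right oct_smult_smult oct_smult_1)
  qed
  show ?thesis
  proof
    fix x assume "x \<in> Gv v"
    then obtain k d where k: "k \<in> G0" "d \<in> Zphi" "x = k + oct_smult d (half v)"
      by (auto simp: Gv_def)
    then have "x = (k + oct_smult d g) + oct_smult (d * c) (half w)"
      by (simp add: half_v oct_smult_add_right oct_smult_smult add.assoc)
    moreover have "k + oct_smult d g \<in> G0" "d * c \<in> Zphi"
      using k g c by (simp_all add: G0_add G0_smult Zphi_mult)
    ultimately show "x \<in> Gv w"
      unfolding Gv_def by blast
  qed
qed

lemma Gv_depends_only_on_line:
  assumes "v \<in> G0" "w \<in> G0"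
    and "line_spanned G0_mod2 (G0_class v) = line_spanned G0_mod2 (G0_class w)"
  shows "Gv v = Gv w"
proof -
  \<comment> \<open>The scalar 1 puts each class on its own line, so equality of the lines yields
    both inclusions.\<close>
  have "G0_class u \<in> line_spanned G0_mod2 (G0_class u)" if "u \<in> G0" for u
  proof -
    have "F4_class 1 \<odot>\<^bsub>G0_mod2\<^esub> G0_class u = G0_class u"
      using that by (simp add: G0_mod2_smult Zphi_1 oct_smult_1)
    then show ?thesis
      unfolding line_spanned_def F4_carrier using Zphi_1 by blast
  qed
  with assms show ?thesis
    by (intro equalityI Gv_subset) auto
qed

text \<open>In the projective form each line comes with a lattice vector whose class spans it, so
  the vector form excludes it for every choice of isomorphism.\<close>

theorem proposition6p10:
  shows "field F4 \<and> card (carrier F4) = 4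
    \<and> Module.module F4 G0_mod2 \<and> Module.module F4 F4_pow8
    \<and> (\<exists>h. module_iso G0_mod2 F4_pow8 h)
    \<and> (\<forall>v\<in>G0 - two_G0. \<forall>w\<in>G0 - two_G0.
         line_spanned G0_mod2 (G0_class v) = line_spanned G0_mod2 (G0_class w) \<longrightarrow> Gv v = Gv w)
    \<and> \<not> (\<exists>v\<in>G0 - two_G0. passes_all_tests v)
    \<and> (\<forall>h. module_iso G0_mod2 F4_pow8 h \<longrightarrow>
         \<not> (\<exists>L\<in>proj_lines F4_pow8. \<exists>v\<in>G0 - two_G0.
              L = line_spanned F4_pow8 (h (G0_class v)) \<and> passes_all_tests v))"
  using field_F4 card_F4 module_G0_mod2 module_F4_pow8 G0_mod2_iso_F4_pow8
    Gv_depends_only_on_line no_vector_passes_all_tests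
  by (intro conjI) (blast | simp)+

end
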